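(* Let $(M,P,g)$ be a Riemannian almost product $\mathcal{W}_3$-manifold with Levi-Civita connection $\nabla$ and canonical connection $\nabla'$. If the curvature tensor $R'$ of $\nabla'$ is a Riemannian $P$-tensor, then \[ g\bigl((\nabla_xP)Pz+(\nabla_{Px}P)z,\;(\nabla_{Py}P)w-(\nabla_yP)Pw\bigr)=0 \] for all $x,y,z,w$.
   Context: A Riemannian almost product manifold $(M,P,g)$ is a differentiable manifold $M$ with a $(1,1)$-tensor field $P$ and a Riemannian metric $g$ such that $P^2x=x$ and $g(Px,Py)=g(x,y)$ for all vector fields $x,y$; throughout it is assumed that $\mathrm{tr}\,P=0$. Let $\nabla$ be the Levi-Civita connection of $g$ and $F(x,y,z)=g((\nabla_xP)y,z)$. $(M,P,g)$ is a Riemannian almost product $\mathcal{W}_3$-manifold if $F(x,y,z)+F(y,z,x)+F(z,x,y)=0$ for all $x,y,z$. A natural connection is a linear connection $\nabla'$ with $\nabla'P=0$ and $\nabla'g=0$; its torsion is $T(x,y)=\nabla'_xy-\nabla'_yx-[x,y]$, with $T(x,y,z)=g(T(x,y),z)$. The canonical connection is the natural connection whose torsion satisfies \[T(x,y,z)+T(y,z,x)+T(Px,y,Pz)+T(y,Pz,Px)=0\] for all $x,y,z$; it is known that it exists and is unique on every Riemannian almost product manifold. The curvature tensor of $\nabla'$ is $R'(x,y)z=\nabla'_x\nabla'_yz-\nabla'_y\nabla'_xz-\nabla'_{[x,y]}z$, $R'(x,y,z,w)=g(R'(x,y)z,w)$. A $(0,4)$-tensor $L$ is called a Riemannian $P$-tensor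 if for all $x,y,z,w$: $L(x,y,z,w)=-L(y,x,z,w)=-L(x,y,w,z)$; $L(x,y,z,w)+L(y,z,x,w)+L(z,x,y,w)=0$; and $L(x,y,Pz,Pw)=L(x,y,z,w)$. *)

theory Defs
  imports "HOL-Analysis.Analysis" "HOL-Library.Function_Algebras"
begin

section \<open>Pointwise real vector space structure on functions\<close>

instantiation "fun" :: (type, real_vector) real_vector
begin

definition scaleR_fun :: "real \<Rightarrow> ('a \<Rightarrow> 'b) \<Rightarrow> 'a \<Rightarrow> 'b" where
  "scaleR_fun c f = (\<lambda>x. c *\<^sub>R f x)"

instance
  by standard (simp_all add: scaleR_fun_def fun_eq_iff algebra_simps)

end

section \<open>Smooth manifolds\<close>

text \<open>\<open>Ck_on k S f\<close>: \<open>f\<close> is \<open>k\<close> times continuously differentiable on the open set \<open>S\<close>.\<close>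

fun Ck_on :: "nat \<Rightarrow> 'e::euclidean_space set \<Rightarrow> ('e \<Rightarrow> 'f::real_normed_vector) \<Rightarrow> bool" where
  "Ck_on 0 S f \<longleftrightarrow> continuous_on S f"
| "Ck_on (Suc k) S f \<longleftrightarrow> (\<forall>x\<in>S. f differentiable (at x)) \<and>
     (\<forall>v. Ck_on k S (\<lambda>x. frechet_derivative f (at x) v))"

definition smooth_on :: "'e::euclidean_space set \<Rightarrow> ('e \<Rightarrow> 'f::real_normed_vector) \<Rightarrow> bool" where
  "smooth_on S f \<longleftrightarrow> (\<forall>k. Ck_on k S f)"

type_synonym ('a, 'e) chart = "'a set \<times> ('a \<Rightarrow> 'e)"

definition is_chart :: "('a::topological_space, 'e::euclidean_space) chart \<Rightarrow> bool" where
  "is_chart = (\<lambda>(U, \<phi>). open U \<and> open (\<phi> ` U) \<and> homeomorphism U (\<phi> ` U) \<phi> (inv_into U \<phi>))"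

text \<open>The manifold is the whole type \<open>'a\<close>, a second countable Hausdorff space, with the smooth
  structure generated by the (not necessarily maximal) atlas \<open>A\<close>; its dimension is that of the
  model space \<open>'e\<close>.\<close>

definition smooth_atlas ::
  "('a::{t2_space, second_countable_topology}, 'e::euclidean_space) chart set \<Rightarrow> bool" where
  "smooth_atlas A \<longleftrightarrow>
     (\<forall>c\<in>A. is_chart c) \<and> (\<Union>c\<in>A. fst c) = UNIV \<and>
     (\<forall>(U, \<phi>)\<in>A. \<forall>(V, \<psi>)\<in>A. smooth_on (\<phi> ` (U \<inter> V)) (\<psi> \<circ> inv_into U \<phi>))"

definition smooth_fun :: "('a, 'e::euclidean_space) chart set \<Rightarrow> ('a \<Rightarrow> real) \<Rightarrow> bool" where
  "smooth_fun A f \<longleftrightarrow> (\<forall>(U, \<phi>)\<in>A. smooth_on (\<phi> ` U) (f \<circ> inv_into U \<phi>))"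

text \<open>Tangent vectors at \<open>p\<close> are the derivations at \<open>p\<close> of the algebra of smooth functions.
  A derivation is represented by a function on all of \<open>'a \<Rightarrow> real\<close>; setting it to \<open>0\<close> on
  nonsmooth functions makes equality of tangent vectors the equality of HOL.\<close>

type_synonym 'a tvec = "('a \<Rightarrow> real) \<Rightarrow> real"

definition tangent_space :: "('a, 'e::euclidean_space) chart set \<Rightarrow> 'a \<Rightarrow> 'a tvec set" where
  "tangent_space A p = {v.
     (\<forall>f h. smooth_fun A f \<longrightarrow> smooth_fun A h \<longrightarrow> v (f + h) = v f + v h) \<and>
     (\<forall>c f. smooth_fun A f \<longrightarrow> v (c *\<^sub>R f) = c * v f) \<and>
     (\<forall>f h. smooth_fun A f \<longrightarrow> smooth_fun A h \<longrightarrow> v (f * h) = v f * h p + f p * v h) \<and>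
     (\<forall>f. \<not> smooth_fun A f \<longrightarrow> v f = 0)}"

type_synonym 'a vfield = "'a \<Rightarrow> 'a tvec"

definition fderiv :: "'a vfield \<Rightarrow> ('a \<Rightarrow> real) \<Rightarrow> ('a \<Rightarrow> real)" where
  "fderiv X f = (\<lambda>p. X p f)"

definition vector_fields :: "('a, 'e::euclidean_space) chart set \<Rightarrow> 'a vfield set" where
  "vector_fields A = {X. (\<forall>p. X p \<in> tangent_space A p) \<and>
     (\<forall>f. smooth_fun A f \<longrightarrow> smooth_fun A (fderiv X f))}"

definition fmult :: "('a \<Rightarrow> real) \<Rightarrow> 'a vfield \<Rightarrow> 'a vfield" where
  "fmult f X = (\<lambda>p. f p *\<^sub>R X p)"

text \<open>On a nonsmooth \<open>f\<close> the bracket vanishes, since then \<open>fderiv X f = fderiv Y f = 0\<close>.\<close>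

definition lie_bracket :: "'a vfield \<Rightarrow> 'a vfield \<Rightarrow> 'a vfield" where
  "lie_bracket X Y = (\<lambda>p f. X p (fderiv Y f) - Y p (fderiv X f))"

section \<open>Tensor fields, metrics and connections\<close>

text \<open>Trace of a linear endomorphism \<open>L\<close> of the finite-dimensional subspace \<open>V\<close>, computed in an
  arbitrary basis of \<open>V\<close>.\<close>

definition trace_on :: "'v::real_vector set \<Rightarrow> ('v \<Rightarrow> 'v) \<Rightarrow> real" where
  "trace_on V L = (let B = (SOME B. independent B \<and> span B = V)
     in \<Sum>b\<in>B. representation B (L b) b)"

type_synonym 'a endo = "'a \<Rightarrow> 'a tvec \<Rightarrow> 'a tvec"

definition endo_app :: "'a endo \<Rightarrow> 'a vfield \<Rightarrow> 'a vfield" where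
  "endo_app P X = (\<lambda>p. P p (X p))"

definition endo_field :: "('a, 'e::euclidean_space) chart set \<Rightarrow> 'a endo \<Rightarrow> bool" where
  "endo_field A P \<longleftrightarrow>
     (\<forall>p. \<forall>u\<in>tangent_space A p. P p u \<in> tangent_space A p) \<and>
     (\<forall>p. \<forall>u\<in>tangent_space A p. \<forall>v\<in>tangent_space A p. P p (u + v) = P p u + P p v) \<and>
     (\<forall>p c. \<forall>u\<in>tangent_space A p. P p (c *\<^sub>R u) = c *\<^sub>R P p u) \<and>
     (\<forall>X\<in>vector_fields A. endo_app P X \<in> vector_fields A)"

type_synonym 'a metric = "'a \<Rightarrow> 'a tvec \<Rightarrow> 'a tvec \<Rightarrow> real"

definition metric_app :: "'a metric \<Rightarrow> 'a vfield \<Rightarrow> 'a vfield \<Rightarrow> ('a \<Rightarrow> real)" where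
  "metric_app g X Y = (\<lambda>p. g p (X p) (Y p))"

definition riemannian_metric :: "('a, 'e::euclidean_space) chart set \<Rightarrow> 'a metric \<Rightarrow> bool" where
  "riemannian_metric A g \<longleftrightarrow>
     (\<forall>p. \<forall>u\<in>tangent_space A p. \<forall>v\<in>tangent_space A p. g p u v = g p v u) \<and>
     (\<forall>p. \<forall>u\<in>tangent_space A p. \<forall>v\<in>tangent_space A p. \<forall>w\<in>tangent_space A p.
        g p (u + v) w = g p u w + g p v w) \<and>
     (\<forall>p c. \<forall>u\<in>tangent_space A p. \<forall>v\<in>tangent_space A p. g p (c *\<^sub>R u) v = c * g p u v) \<and>
     (\<forall>p. \<forall>u\<in>tangent_space A p. u \<noteq> 0 \<longrightarrow> g p u u > 0) \<and>
     (\<forall>X\<in>vector_fields A. \<forall>Y\<in>vector_fields A. smooth_fun A (metric_app g X Y))"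

type_synonym 'a connection = "'a vfield \<Rightarrow> 'a vfield \<Rightarrow> 'a vfield"

definition linear_connection :: "('a, 'e::euclidean_space) chart set \<Rightarrow> 'a connection \<Rightarrow> bool" where
  "linear_connection A D \<longleftrightarrow>
     (\<forall>X\<in>vector_fields A. \<forall>Y\<in>vector_fields A. D X Y \<in> vector_fields A) \<and>
     (\<forall>X\<in>vector_fields A. \<forall>Y\<in>vector_fields A. \<forall>Z\<in>vector_fields A.
        D (X + Y) Z = D X Z + D Y Z \<and> D X (Y + Z) = D X Y + D X Z) \<and>
     (\<forall>f. \<forall>X\<in>vector_fields A. \<forall>Y\<in>vector_fields A. smooth_fun A f \<longrightarrow>
        D (fmult f X) Y = fmult f (D X Y) \<and>
        D X (fmult f Y) = fmult (fderiv X f) Y + fmult f (D X Y))"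

definition torsion :: "'a connection \<Rightarrow> 'a vfield \<Rightarrow> 'a vfield \<Rightarrow> 'a vfield" where
  "torsion D X Y = D X Y - D Y X - lie_bracket X Y"

definition curvature :: "'a connection \<Rightarrow> 'a vfield \<Rightarrow> 'a vfield \<Rightarrow> 'a vfield \<Rightarrow> 'a vfield" where
  "curvature D X Y Z = D X (D Y Z) - D Y (D X Z) - D (lie_bracket X Y) Z"

text \<open>\<open>cov_endo D P X Y\<close> is \<open>(D\<^sub>X P) Y\<close> and \<open>cov_metric D g X Y Z\<close> is \<open>(D\<^sub>X g)(Y, Z)\<close>.\<close>

definition cov_endo :: "'a connection \<Rightarrow> 'a endo \<Rightarrow> 'a vfield \<Rightarrow> 'a vfield \<Rightarrow> 'a vfield" where
  "cov_endo D P X Y = D X (endo_app P Y) - endo_app P (D X Y)"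

definition cov_metric ::
  "'a connection \<Rightarrow> 'a metric \<Rightarrow> 'a vfield \<Rightarrow> 'a vfield \<Rightarrow> 'a vfield \<Rightarrow> ('a \<Rightarrow> real)" where
  "cov_metric D g X Y Z =
     fderiv X (metric_app g Y Z) - metric_app g (D X Y) Z - metric_app g Y (D X Z)"

definition metric_connection ::
  "('a, 'e::euclidean_space) chart set \<Rightarrow> 'a metric \<Rightarrow> 'a connection \<Rightarrow> bool" where
  "metric_connection A g D \<longleftrightarrow>
     (\<forall>X\<in>vector_fields A. \<forall>Y\<in>vector_fields A. \<forall>Z\<in>vector_fields A. cov_metric D g X Y Z = 0)"

definition levi_civita ::
  "('a, 'e::euclidean_space) chart set \<Rightarrow> 'a metric \<Rightarrow> 'a connection \<Rightarrow> bool" where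
  "levi_civita A g D \<longleftrightarrow> linear_connection A D \<and> metric_connection A g D \<and>
     (\<forall>X\<in>vector_fields A. \<forall>Y\<in>vector_fields A. torsion D X Y = 0)"

section \<open>Riemannian almost product manifolds\<close>

definition riemannian_almost_product ::
  "('a::{t2_space, second_countable_topology}, 'e::euclidean_space) chart set
    \<Rightarrow> 'a endo \<Rightarrow> 'a metric \<Rightarrow> bool" where
  "riemannian_almost_product A P g \<longleftrightarrow>
     smooth_atlas A \<and> endo_field A P \<and> riemannian_metric A g \<and>
     (\<forall>X\<in>vector_fields A. endo_app P (endo_app P X) = X) \<and>
     (\<forall>X\<in>vector_fields A. \<forall>Y\<in>vector_fields A.
        metric_app g (endo_app P X) (endo_app P Y) = metric_app g X Y) \<and>
     (\<forall>p. trace_on (tangent_space A p) (P p) = 0)"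

text \<open>The tensor \<open>F(X, Y, Z) = g((D\<^sub>X P) Y, Z)\<close>, where \<open>D\<close> is the Levi-Civita connection.\<close>

definition F_tensor :: "'a metric \<Rightarrow> 'a endo \<Rightarrow> 'a connection
    \<Rightarrow> 'a vfield \<Rightarrow> 'a vfield \<Rightarrow> 'a vfield \<Rightarrow> ('a \<Rightarrow> real)" where
  "F_tensor g P D X Y Z = metric_app g (cov_endo D P X Y) Z"

text \<open>The second argument of \<open>W3_manifold\<close> is meant to be the Levi-Civita connection of \<open>g\<close>.\<close>

definition W3_manifold ::
  "('a::{t2_space, second_countable_topology}, 'e::euclidean_space) chart set
    \<Rightarrow> 'a connection \<Rightarrow> 'a endo \<Rightarrow> 'a metric \<Rightarrow> bool" where
  "W3_manifold A D P g \<longleftrightarrow> riemannian_almost_product A P g \<and>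
     (\<forall>X\<in>vector_fields A. \<forall>Y\<in>vector_fields A. \<forall>Z\<in>vector_fields A.
        F_tensor g P D X Y Z + F_tensor g P D Y Z X + F_tensor g P D Z X Y = 0)"

definition natural_connection ::
  "('a, 'e::euclidean_space) chart set \<Rightarrow> 'a endo \<Rightarrow> 'a metric \<Rightarrow> 'a connection \<Rightarrow> bool" where
  "natural_connection A P g D \<longleftrightarrow> linear_connection A D \<and> metric_connection A g D \<and>
     (\<forall>X\<in>vector_fields A. \<forall>Y\<in>vector_fields A. cov_endo D P X Y = 0)"

definition torsion3 :: "'a metric \<Rightarrow> 'a connection
    \<Rightarrow> 'a vfield \<Rightarrow> 'a vfield \<Rightarrow> 'a vfield \<Rightarrow> ('a \<Rightarrow> real)" where
  "torsion3 g D X Y Z = metric_app g (torsion D X Y) Z"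

definition canonical_connection ::
  "('a, 'e::euclidean_space) chart set \<Rightarrow> 'a endo \<Rightarrow> 'a metric \<Rightarrow> 'a connection \<Rightarrow> bool" where
  "canonical_connection A P g D \<longleftrightarrow> natural_connection A P g D \<and>
     (\<forall>X\<in>vector_fields A. \<forall>Y\<in>vector_fields A. \<forall>Z\<in>vector_fields A.
        torsion3 g D X Y Z + torsion3 g D Y Z X
        + torsion3 g D (endo_app P X) Y (endo_app P Z)
        + torsion3 g D Y (endo_app P Z) (endo_app P X) = 0)"

definition curvature4 :: "'a metric \<Rightarrow> 'a connection
    \<Rightarrow> 'a vfield \<Rightarrow> 'a vfield \<Rightarrow> 'a vfield \<Rightarrow> 'a vfield \<Rightarrow> ('a \<Rightarrow> real)" where
  "curvature4 g D X Y Z W = metric_app g (curvature D X Y Z) W"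

text \<open>The (0,4)-tensor \<open>L\<close> is given by its values on vector fields; its multilinearity over the
  smooth functions is not part of this predicate.\<close>

definition riemannian_P_tensor :: "('a, 'e::euclidean_space) chart set \<Rightarrow> 'a endo
    \<Rightarrow> ('a vfield \<Rightarrow> 'a vfield \<Rightarrow> 'a vfield \<Rightarrow> 'a vfield \<Rightarrow> ('a \<Rightarrow> real)) \<Rightarrow> bool" where
  "riemannian_P_tensor A P L \<longleftrightarrow>
     (\<forall>X\<in>vector_fields A. \<forall>Y\<in>vector_fields A. \<forall>Z\<in>vector_fields A. \<forall>W\<in>vector_fields A.
        L X Y Z W = - L Y X Z W \<and>
        L X Y Z W = - L X Y W Z \<and>
        L X Y Z W + L Y Z X W + L Z X Y W = 0 \<and>
        L X Y (endo_app P Z) (endo_app P W) = L X Y Z W)"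

end

theory Submission
  imports Defs
begin

text \<open>Write \<open>J\<close> for \<open>P\<close> acting on fields and split every field into its \<open>+1\<close> and \<open>-1\<close> eigenfields.
  In the class W3 both eigendistributions have a skew second fundamental form: the
  component of \<open>D X Y\<close> normal to the distribution of \<open>X\<close> and \<open>Y\<close> is half that of \<open>lie_bracket X Y\<close>
  (\<open>second_fundamental_form_skew\<close>). This pins down the torsion \<open>T\<close> of the canonical connection:
  \<open>T X Y = 0\<close> if \<open>X\<close> and \<open>Y\<close> are eigenfields of opposite sign (\<open>torsion_opposite\<close>), and if the signs
  agree, \<open>T X Y\<close> is \<open>-2\<close> times the normal component of \<open>D X Y\<close>, an eigenfield of the other
  sign (\<open>torsion_integrability\<close>, \<open>eigenfield_torsion\<close>). Thus \<open>T\<close> is the obstruction to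
  integrability of the two distributions.

  The two fields in the theorem are therefore expressions in \<open>T\<close>: the first one is \<open>- 2 T x z\<close>
  (\<open>cov_endo_sum_eq_torsion\<close>), and the second one, call it \<open>V\<close>, satisfies
  \<open>g(V, u) = - 2 g(T y u, w)\<close> for every \<open>u\<close> (\<open>cov_endo_diff_eq_torsion\<close>). Hence their inner product is
  \<open>4 g(T y (T x z), w)\<close>, and everything reduces to \<open>T y (T x z) = 0\<close>.

  That is the first Bianchi identity. Since the cyclic sum of the curvature vanishes,
  the right-hand side of \<open>first_Bianchi_with_torsion\<close> is zero. For \<open>x\<close>, \<open>z\<close> of one
  sign and \<open>y\<close> of the other, \<open>D'\<close> preserves eigenfields and \<open>T\<close> takes its values as above,
  so the component with the sign of \<open>x\<close> consists of the single term \<open>T y (T x z)\<close>, up to sign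
  (\<open>torsion_torsion_eigenfields\<close>). All other combinations of signs are trivial.\<close>

section \<open>Smooth functions and vector fields\<close>

text \<open>The iterated derivatives in \<open>Ck_on\<close> are taken of functions known only on \<open>S\<close>; since
  \<open>S\<close> is open, values off \<open>S\<close> do not affect derivatives at its points.\<close>

lemma Ck_on_cong:
  assumes "open S" "\<And>x. x \<in> S \<Longrightarrow> f x = h x" "Ck_on k S f"
  shows "Ck_on k S h"
  using assms(2,3)
proof (induction k arbitrary: f h)
  case 0
  then show ?case by (simp cong: continuous_on_cong)
next
  case (Suc k)
  have d: "(h has_derivative frechet_derivative f (at x)) (at x)" if "x \<in> S" for x
    using that Suc.prems \<open>open S\<close>
    by (auto intro: has_derivative_transform_within_open simp: frechet_derivative_works)
  have "Ck_on k S (\<lambda>x. frechet_derivative h (at x) v)" for v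
    by (rule Suc.IH[where f = "\<lambda>x. frechet_derivative f (at x) v"])
      (use Suc.prems frechet_derivative_at[OF d] in auto)
  then show ?case using d by (auto simp: differentiable_def)
qed

lemma Ck_on_const: "Ck_on k S (\<lambda>x. c)"
  by (induction k arbitrary: c) (simp_all add: frechet_derivative_const)

lemma Ck_on_add_scaleR:
  assumes "open S" "Ck_on k S f" "Ck_on k S h"
  shows "Ck_on k S (\<lambda>x. f x + c *\<^sub>R h x)"
  using assms(2,3)
proof (induction k arbitrary: f h)
  case 0
  then show ?case by (auto intro!: continuous_intros)
next
  case (Suc k)
  have d: "((\<lambda>x. f x + c *\<^sub>R h x) has_derivative
      (\<lambda>v. frechet_derivative f (at x) v + c *\<^sub>R frechet_derivative h (at x) v)) (at x)"
    if "x \<in> S" for x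
    using that Suc.prems
    by (intro has_derivative_add has_derivative_scaleR_right) (auto simp: frechet_derivative_works)
  have "Ck_on k S (\<lambda>x. frechet_derivative (\<lambda>x. f x + c *\<^sub>R h x) (at x) v)" for v
  proof (rule Ck_on_cong[OF \<open>open S\<close>])
    show "Ck_on k S (\<lambda>x. frechet_derivative f (at x) v + c *\<^sub>R frechet_derivative h (at x) v)"
      using Suc by simp
  qed (simp add: frechet_derivative_at[OF d, symmetric])
  then show ?case using d by (auto simp: differentiable_def)
qed

lemma smooth_fun_const: "smooth_fun A (\<lambda>_. c)"
  by (auto simp: smooth_fun_def smooth_on_def o_def Ck_on_const)

lemma smooth_fun_0: "smooth_fun A 0"
  using smooth_fun_const[of A 0] by (simp add: zero_fun_def)

lemma smooth_fun_add_scaleR: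
  assumes "smooth_atlas A" "smooth_fun A f" "smooth_fun A h"
  shows "smooth_fun A (f + c *\<^sub>R h)"
  unfolding smooth_fun_def smooth_on_def
proof safe
  fix U \<phi> k assume c: "(U, \<phi>) \<in> A"
  have "open (\<phi> ` U)"
    using c assms(1) by (auto simp: smooth_atlas_def is_chart_def)
  note Ck_on_add_scaleR[OF this]
  moreover have "Ck_on k (\<phi> ` U) (f \<circ> inv_into U \<phi>)" "Ck_on k (\<phi> ` U) (h \<circ> inv_into U \<phi>)"
    using c assms(2,3) by (auto simp: smooth_fun_def smooth_on_def)
  ultimately have "Ck_on k (\<phi> ` U) (\<lambda>x. (f \<circ> inv_into U \<phi>) x + c *\<^sub>R (h \<circ> inv_into U \<phi>) x)"
    by blast
  then show "Ck_on k (\<phi> ` U) ((f + c *\<^sub>R h) \<circ> inv_into U \<phi>)"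
    by (simp add: o_def scaleR_fun_def plus_fun_def)
qed

lemma scaleR_fun_apply: "(c *\<^sub>R f) x = c *\<^sub>R f x"
  by (simp add: scaleR_fun_def)

lemma tangent_space_add:
  assumes "u \<in> tangent_space A p" "v \<in> tangent_space A p"
  shows "u + v \<in> tangent_space A p"
  using assms by (simp add: tangent_space_def algebra_simps)

lemma tangent_space_scaleR:
  assumes "u \<in> tangent_space A p"
  shows "c *\<^sub>R u \<in> tangent_space A p"
  using assms by (simp add: tangent_space_def scaleR_fun_def algebra_simps)

lemma tangent_vector_0:
  assumes "v \<in> tangent_space A p"
  shows "v 0 = 0"
proof -
  have "v (0 *\<^sub>R 0) = 0 * v 0"
    using assms smooth_fun_0[of A] unfolding tangent_space_def by blast
  then show ?thesis by simp
qed

lemma tangent_vector_diff: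
  assumes "v \<in> tangent_space A p" "smooth_atlas A" "smooth_fun A f" "smooth_fun A h"
  shows "v (f - h) = v f - v h"
proof -
  have "smooth_fun A (f - h)"
    using smooth_fun_add_scaleR[OF assms(2-4), of "-1"] by simp
  then have "v ((f - h) + h) = v (f - h) + v h"
    using assms unfolding tangent_space_def by blast
  then show ?thesis by simp
qed

text \<open>The product rule for \<open>1 = 1 * 1\<close> gives \<open>v 1 = 2 * v 1\<close>.\<close>

lemma tangent_vector_const:
  assumes "v \<in> tangent_space A p"
  shows "v (\<lambda>_. c) = 0"
proof -
  let ?one = "\<lambda>_. 1 :: real"
  have s: "smooth_fun A ?one" by (rule smooth_fun_const)
  have "v (?one * ?one) = v ?one * ?one p + ?one p * v ?one"
    using assms s unfolding tangent_space_def by blast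
  then have 1: "v ?one = 0" by (simp add: times_fun_def)
  have "v (c *\<^sub>R ?one) = c * v ?one"
    using assms s unfolding tangent_space_def by blast
  with 1 show ?thesis by (simp add: scaleR_fun_def)
qed

lemma subspace_vector_fields:
  assumes "smooth_atlas A"
  shows "subspace (vector_fields A)"
proof (rule subspaceI)
  show "0 \<in> vector_fields A"
    by (auto simp: vector_fields_def tangent_space_def fderiv_def smooth_fun_const)
next
  fix X Y assume XY: "X \<in> vector_fields A" "Y \<in> vector_fields A"
  have "smooth_fun A (fderiv (X + Y) f)" if "smooth_fun A f" for f
  proof -
    have "fderiv (X + Y) f = fderiv X f + 1 *\<^sub>R fderiv Y f"
      by (simp add: fderiv_def fun_eq_iff)
    moreover have "smooth_fun A (fderiv X f)" "smooth_fun A (fderiv Y f)"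
      using XY that by (auto simp: vector_fields_def)
    ultimately show ?thesis
      using smooth_fun_add_scaleR[OF assms] by metis
  qed
  with XY show "X + Y \<in> vector_fields A"
    by (simp add: vector_fields_def tangent_space_add)
next
  fix X and c :: real assume X: "X \<in> vector_fields A"
  have "smooth_fun A (fderiv (c *\<^sub>R X) f)" if "smooth_fun A f" for f
  proof -
    have "fderiv (c *\<^sub>R X) f = 0 + c *\<^sub>R fderiv X f"
      by (simp add: fderiv_def scaleR_fun_def fun_eq_iff)
    moreover have "smooth_fun A (fderiv X f)"
      using X that by (auto simp: vector_fields_def)
    ultimately show ?thesis
      using smooth_fun_add_scaleR[OF assms smooth_fun_0] by metis
  qed
  with X show "c *\<^sub>R X \<in> vector_fields A"
    by (simp add: vector_fields_def tangent_space_scaleR scaleR_fun_apply)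
qed

lemma lie_bracket_Jacobi:
  fixes X Y Z :: "'a::{t2_space, second_countable_topology} vfield"
  assumes "smooth_atlas A" "X \<in> vector_fields A" "Y \<in> vector_fields A" "Z \<in> vector_fields A"
  shows "lie_bracket X (lie_bracket Y Z) + lie_bracket Y (lie_bracket Z X)
    + lie_bracket Z (lie_bracket X Y) = 0"
proof (intro ext)
  fix p :: 'a and f :: "'a \<Rightarrow> real"
  have B: "fderiv (lie_bracket X Y) f = fderiv X (fderiv Y f) - fderiv Y (fderiv X f)"
    for X Y :: "'a vfield"
    by (simp add: fun_eq_iff fderiv_def lie_bracket_def)
  have t: "X p (fderiv Y (fderiv Z f) - fderiv Z (fderiv Y f))
      = X p (fderiv Y (fderiv Z f)) - X p (fderiv Z (fderiv Y f))"
    if "X \<in> vector_fields A" "Y \<in> vector_fields A" "Z \<in> vector_fields A" for X Y Z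
  proof (cases "smooth_fun A f")
    case True
    then show ?thesis
      using that by (intro tangent_vector_diff[OF _ assms(1)]) (auto simp: vector_fields_def)
  next
    case False
    \<comment> \<open>Tangent vectors take the default value \<open>0\<close> on nonsmooth functions, so every term vanishes.\<close>
    have 0: "fderiv W f = 0" "fderiv W 0 = 0" if "W \<in> vector_fields A" for W
      using that False
      by (auto simp: fderiv_def vector_fields_def tangent_space_def fun_eq_iff
          intro!: tangent_vector_0)
    have "X p 0 = 0"
      using that by (auto simp: vector_fields_def intro: tangent_vector_0)
    with 0 that show ?thesis by simp
  qed
  show "(lie_bracket X (lie_bracket Y Z) + lie_bracket Y (lie_bracket Z X)
    + lie_bracket Z (lie_bracket X Y)) p f = 0 p f"
    using assms(2-4) by (simp add: lie_bracket_def[of _ "lie_bracket _ _"] B t)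
      (simp add: lie_bracket_def fderiv_def)
qed

section \<open>Linear connections over the real numbers\<close>

lemma fmult_const: "fmult (\<lambda>_. c) X = c *\<^sub>R X"
  by (simp add: fmult_def scaleR_fun_def)

text \<open>A real number is a constant function; the Leibniz term vanishes because vector fields
  annihilate constants.\<close>

lemma linear_connection_scaleR:
  assumes "linear_connection A D" "X \<in> vector_fields A" "Y \<in> vector_fields A"
  shows "D (c *\<^sub>R X) Y = c *\<^sub>R D X Y" "D X (c *\<^sub>R Y) = c *\<^sub>R D X Y"
proof -
  have "fderiv X (\<lambda>_. c) = 0"
    using assms(2) by (auto simp: fderiv_def vector_fields_def fun_eq_iff intro: tangent_vector_const)
  moreover have "fmult 0 Y = 0"
    by (simp add: fmult_def fun_eq_iff)
  moreover have "D (fmult (\<lambda>_. c) X) Y = fmult (\<lambda>_. c) (D X Y)"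
    "D X (fmult (\<lambda>_. c) Y) = fmult (fderiv X (\<lambda>_. c)) Y + fmult (\<lambda>_. c) (D X Y)"
    using assms smooth_fun_const[of A c] unfolding linear_connection_def by blast+
  ultimately show "D (c *\<^sub>R X) Y = c *\<^sub>R D X Y" "D X (c *\<^sub>R Y) = c *\<^sub>R D X Y"
    by (simp_all add: fmult_const)
qed

lemma linear_connection_diff:
  assumes "linear_connection A D" "smooth_atlas A"
    and "X \<in> vector_fields A" "Y \<in> vector_fields A" "Z \<in> vector_fields A"
  shows "D (X - Y) Z = D X Z - D Y Z" "D X (Y - Z) = D X Y - D X Z"
proof -
  have d: "X - Y \<in> vector_fields A" "Y - Z \<in> vector_fields A"
    using assms subspace_vector_fields by (auto intro: subspace_diff)
  have "D ((X - Y) + Y) Z = D (X - Y) Z + D Y Z" "D X ((Y - Z) + Z) = D X (Y - Z) + D X Z"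
    using assms d unfolding linear_connection_def by blast+
  then show "D (X - Y) Z = D X Z - D Y Z" "D X (Y - Z) = D X Y - D X Z"
    by (simp_all add: algebra_simps)
qed

text \<open>Expand \<open>D X (D Y Z - D Z Y)\<close> as \<open>D X (torsion D Y Z + lie_bracket Y Z)\<close> and trade
  \<open>D X (lie_bracket Y Z) - D (lie_bracket Y Z) X\<close> for a torsion and a double bracket; the
  double brackets cancel by the Jacobi identity. In this form, unlike the usual one with
  the covariant derivative of the torsion, every term is directly accessible once it is known
  on which fields the torsion vanishes.\<close>

lemma first_Bianchi_with_torsion:
  assumes "linear_connection A D" "smooth_atlas A"
    and "X \<in> vector_fields A" "Y \<in> vector_fields A" "Z \<in> vector_fields A"
    and br: "\<And>X Y. X \<in> vector_fields A \<Longrightarrow> Y \<in> vector_fields A \<Longrightarrow> lie_bracket X Y \<in> vector_fields A"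
  shows "curvature D X Y Z + curvature D Y Z X + curvature D Z X Y =
      D X (torsion D Y Z) + D Y (torsion D Z X) + D Z (torsion D X Y)
    + torsion D X (lie_bracket Y Z) + torsion D Y (lie_bracket Z X) + torsion D Z (lie_bracket X Y)"
proof -
  have DV: "D U W \<in> vector_fields A" if "U \<in> vector_fields A" "W \<in> vector_fields A" for U W
    using assms(1) that unfolding linear_connection_def by blast
  have sub: "U - W \<in> vector_fields A" if "U \<in> vector_fields A" "W \<in> vector_fields A" for U W
    using subspace_diff[OF subspace_vector_fields[OF assms(2)] that] .
  have DT: "D U (torsion D V W) = D U (D V W) - D U (D W V) - D U (lie_bracket V W)"
    if "U \<in> vector_fields A" "V \<in> vector_fields A" "W \<in> vector_fields A" for U V W
    using that by (simp add: torsion_def linear_connection_diff[OF assms(1,2)] DV br sub)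
  have "curvature D X Y Z + curvature D Y Z X + curvature D Z X Y -
     (D X (torsion D Y Z) + D Y (torsion D Z X) + D Z (torsion D X Y)
    + torsion D X (lie_bracket Y Z) + torsion D Y (lie_bracket Z X) + torsion D Z (lie_bracket X Y))
    = lie_bracket X (lie_bracket Y Z) + lie_bracket Y (lie_bracket Z X)
      + lie_bracket Z (lie_bracket X Y)"
    using assms(3-5) by (simp add: DT curvature_def torsion_def[of D _ "lie_bracket _ _"])
  also have "\<dots> = 0" by (rule lie_bracket_Jacobi[OF assms(2-5)])
  finally show ?thesis by simp
qed

section \<open>Eigenfields of the almost product structure\<close>

locale canonical_W3 =
  fixes A :: "('a::{t2_space, second_countable_topology}, 'e::euclidean_space) chart set"
    and P :: "'a endo" and g :: "'a metric"
    and D D' :: "'a connection"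
  assumes levi_civita: "levi_civita A g D"
    and W3: "W3_manifold A D P g"
    and canonical: "canonical_connection A P g D'"
begin

abbreviation "VF \<equiv> vector_fields A"
abbreviation "G \<equiv> metric_app g"
abbreviation "J \<equiv> endo_app P"
abbreviation "T \<equiv> torsion D'"

text \<open>The sign \<open>e\<close> is a parameter so that each argument is given once for both
  eigendistributions; \<open>e * e = 1\<close> says that \<open>e\<close> is \<open>1\<close> or \<open>-1\<close>, also when \<open>X = 0\<close>.\<close>

definition eigenfield :: "real \<Rightarrow> 'a vfield \<Rightarrow> bool" where
  "eigenfield e X \<longleftrightarrow> e * e = 1 \<and> X \<in> VF \<and> J X = e *\<^sub>R X"

lemma atlas: "smooth_atlas A"
  and endo: "endo_field A P"
  and metric: "riemannian_metric A g"
  and JJ: "X \<in> VF \<Longrightarrow> J (J X) = X"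
  and J_isometry: "X \<in> VF \<Longrightarrow> Y \<in> VF \<Longrightarrow> G (J X) (J Y) = G X Y"
  using W3 by (auto simp: W3_manifold_def riemannian_almost_product_def)

lemma conn: "linear_connection A D" "linear_connection A D'"
  using levi_civita canonical
  by (auto simp: levi_civita_def canonical_connection_def natural_connection_def)

lemmas VF_subspace = subspace_vector_fields[OF atlas]

lemma VF_closed [simp]:
  "X \<in> VF \<Longrightarrow> Y \<in> VF \<Longrightarrow> X + Y \<in> VF"
  "X \<in> VF \<Longrightarrow> Y \<in> VF \<Longrightarrow> X - Y \<in> VF"
  "X \<in> VF \<Longrightarrow> - X \<in> VF"
  "X \<in> VF \<Longrightarrow> c *\<^sub>R X \<in> VF"
  "X \<in> VF \<Longrightarrow> J X \<in> VF"
  "X \<in> VF \<Longrightarrow> Y \<in> VF \<Longrightarrow> D X Y \<in> VF"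
  "X \<in> VF \<Longrightarrow> Y \<in> VF \<Longrightarrow> D' X Y \<in> VF"
  using VF_subspace conn endo
  by (auto simp: subspace_add subspace_diff subspace_neg subspace_scale
      linear_connection_def endo_field_def)

text \<open>The bracket of two fields is a field because the Levi-Civita connection expresses it
  by covariant derivatives.\<close>

lemma lie_bracket_eq: "X \<in> VF \<Longrightarrow> Y \<in> VF \<Longrightarrow> lie_bracket X Y = D X Y - D Y X"
  using levi_civita by (auto simp: levi_civita_def torsion_def)

lemma VF_brackets [simp]:
  assumes "X \<in> VF" "Y \<in> VF"
  shows "lie_bracket X Y \<in> VF" "T X Y \<in> VF"
  using assms by (simp_all add: torsion_def lie_bracket_eq)

lemma tangent: "X \<in> VF \<Longrightarrow> X p \<in> tangent_space A p"
  by (simp add: vector_fields_def)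

lemma J_linear:
  assumes "X \<in> VF"
  shows "Y \<in> VF \<Longrightarrow> J (X + Y) = J X + J Y" "J (c *\<^sub>R X) = c *\<^sub>R J X"
  using assms endo
  by (auto simp: endo_app_def endo_field_def fun_eq_iff[of _ "_ :: 'a vfield"] tangent scaleR_fun_apply)

lemma G_sym: "X \<in> VF \<Longrightarrow> Y \<in> VF \<Longrightarrow> G X Y p = G Y X p"
  using metric by (simp add: metric_app_def riemannian_metric_def tangent)

lemma G_left:
  assumes "X \<in> VF" "Z \<in> VF"
  shows "Y \<in> VF \<Longrightarrow> G (X + Y) Z p = G X Z p + G Y Z p"
    and "G (c *\<^sub>R X) Z p = c * G X Z p"
    and "G (- X) Z p = - G X Z p"
    and "Y \<in> VF \<Longrightarrow> G (X - Y) Z p = G X Z p - G Y Z p"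
proof -
  have add: "G (X + Y) Z p = G X Z p + G Y Z p" if "Y \<in> VF" for Y
    using metric assms that by (auto simp: metric_app_def riemannian_metric_def tangent)
  have scale: "G (c *\<^sub>R X) Z p = c * G X Z p" if "X \<in> VF" for X c
    using metric assms that
    by (auto simp: metric_app_def riemannian_metric_def tangent scaleR_fun_apply)
  have neg: "G (- X) Z p = - G X Z p" if "X \<in> VF" for X
    using scale[OF that, of "-1"] by simp
  show "Y \<in> VF \<Longrightarrow> G (X + Y) Z p = G X Z p + G Y Z p" "G (c *\<^sub>R X) Z p = c * G X Z p"
    "G (- X) Z p = - G X Z p" "Y \<in> VF \<Longrightarrow> G (X - Y) Z p = G X Z p - G Y Z p"
    using add scale neg add[of "- Y"] assms by simp_all
qed

lemma G_right:
  assumes "X \<in> VF" "Z \<in> VF"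
  shows "Y \<in> VF \<Longrightarrow> G Z (X + Y) p = G Z X p + G Z Y p"
    and "G Z (c *\<^sub>R X) p = c * G Z X p"
    and "G Z (- X) p = - G Z X p"
    and "Y \<in> VF \<Longrightarrow> G Z (X - Y) p = G Z X p - G Z Y p"
  using assms by (simp_all add: G_sym[of Z] G_left)

lemmas G_linear = G_left G_right

lemma G_zero: "X \<in> VF \<Longrightarrow> G 0 X p = 0" "X \<in> VF \<Longrightarrow> G X 0 p = 0"
  using G_left(2)[of X X 0] G_right(2)[of X X 0] by auto

text \<open>Taking \<open>Y = X\<close>, positive definiteness applies at every point.\<close>

lemma eq_zero_by_metric:
  assumes "X \<in> VF" "\<And>Y p. Y \<in> VF \<Longrightarrow> G X Y p = 0"
  shows "X = 0"
proof
  fix p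
  show "X p = 0 p"
    using assms metric tangent[OF assms(1), of p]
    by (force simp: metric_app_def riemannian_metric_def)
qed

lemma J_self_adjoint: "X \<in> VF \<Longrightarrow> Y \<in> VF \<Longrightarrow> G (J X) Y p = G X (J Y) p"
  using J_isometry[of "J X" Y] by (simp add: JJ)

lemma metric_derivative:
  assumes "X \<in> VF" "Y \<in> VF" "Z \<in> VF"
  shows "G (D X Y) Z p + G Y (D X Z) p = X p (G Y Z)"
    and "G (D' X Y) Z p + G Y (D' X Z) p = X p (G Y Z)"
proof -
  have "cov_metric D g X Y Z p = 0" "cov_metric D' g X Y Z p = 0"
    using levi_civita canonical assms
    by (simp_all add: levi_civita_def canonical_connection_def natural_connection_def
        metric_connection_def)
  then show "G (D X Y) Z p + G Y (D X Z) p = X p (G Y Z)"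
    and "G (D' X Y) Z p + G Y (D' X Z) p = X p (G Y Z)"
    by (simp_all add: cov_metric_def fderiv_def)
qed

lemma eigenfield_VF [simp]: "eigenfield e X \<Longrightarrow> X \<in> VF"
  by (simp add: eigenfield_def)

lemma eigenfield_sign: "eigenfield e X \<Longrightarrow> e = 1 \<or> e = - 1"
  by (simp add: eigenfield_def square_eq_1_iff)

lemma eigenfield_square: "eigenfield e X \<Longrightarrow> e * e = 1"
  by (simp add: eigenfield_def)

lemma eigenfield_J: "eigenfield e X \<Longrightarrow> J X = e *\<^sub>R X"
  by (simp add: eigenfield_def)

text \<open>The components are the projections \<open>(X \<plusminus> e J X) / 2\<close>.\<close>

lemma eigenfield_decomposition:
  assumes "X \<in> VF" "e * e = 1"
  obtains Y Z where "eigenfield e Y" "eigenfield (- e) Z" "X = Y + Z"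
proof
  have eig: "eigenfield d ((1/2) *\<^sub>R (X + d *\<^sub>R J X))" if "d * d = 1" for d
  proof -
    \<comment> \<open>An opaque \<open>Y\<close> keeps the factor \<open>1/2\<close> from being distributed over the sum.\<close>
    define Y where "Y = X + d *\<^sub>R J X"
    have "J Y = d *\<^sub>R Y"
      using assms that by (simp add: Y_def J_linear JJ scaleR_add_right)
    moreover have "Y \<in> VF"
      using assms by (simp add: Y_def)
    ultimately show ?thesis
      using that by (simp add: eigenfield_def J_linear flip: Y_def)
  qed
  show "eigenfield e ((1/2) *\<^sub>R (X + e *\<^sub>R J X))"
    using assms(2) by (rule eig)
  show "eigenfield (- e) ((1/2) *\<^sub>R (X + (- e) *\<^sub>R J X))"
    by (rule eig) (simp add: assms(2))
  have "(1/2) *\<^sub>R X + (1/2) *\<^sub>R X = X"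
    by (simp only: scaleR_add_left[symmetric] field_sum_of_halves scaleR_one)
  then show "X = (1/2) *\<^sub>R (X + e *\<^sub>R J X) + (1/2) *\<^sub>R (X + (- e) *\<^sub>R J X)"
    unfolding scaleR_add_right scaleR_minus_left scaleR_minus_right
    by (simp only: add.assoc add.left_commute add.right_inverse add_0_right)
qed

lemma bilinear_zero_by_eigenfields:
  assumes X: "X \<in> VF" and Y: "Y \<in> VF"
    and add: "\<And>X1 X2 Y. X1 \<in> VF \<Longrightarrow> X2 \<in> VF \<Longrightarrow> Y \<in> VF \<Longrightarrow> b (X1 + X2) Y = b X1 Y + b X2 Y"
      "\<And>X Y1 Y2. X \<in> VF \<Longrightarrow> Y1 \<in> VF \<Longrightarrow> Y2 \<in> VF \<Longrightarrow> b X (Y1 + Y2) = b X Y1 + b X Y2"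
    and same: "\<And>e X Y. eigenfield e X \<Longrightarrow> eigenfield e Y \<Longrightarrow> b X Y = 0"
    and opposite: "\<And>e X Y. eigenfield e X \<Longrightarrow> eigenfield (- e) Y \<Longrightarrow> b X Y = 0"
  shows "b X Y = (0 :: 'b :: comm_monoid_add)"
proof -
  obtain X1 X2 where X: "eigenfield 1 X1" "eigenfield (- 1) X2" "X = X1 + X2"
    by (rule eigenfield_decomposition[OF X, of 1]) simp_all
  obtain Y1 Y2 where Y: "eigenfield 1 Y1" "eigenfield (- 1) Y2" "Y = Y1 + Y2"
    by (rule eigenfield_decomposition[OF Y, of 1]) simp_all
  have "b X1 Y1 = 0" "b X2 Y2 = 0" "b X1 Y2 = 0" "b X2 Y1 = 0"
    using same[OF X(1) Y(1)] same[OF X(2) Y(2)] opposite[OF X(1) Y(2)] opposite[OF X(2), of Y1] Y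
    by simp_all
  then show ?thesis using X Y by (simp add: add)
qed

lemma eigenfield_orthogonal:
  assumes "eigenfield e X" "eigenfield (- e) Y"
  shows "G X Y p = 0"
proof -
  have "G (J X) (J Y) p = G X Y p" using assms J_isometry by simp
  then show ?thesis
    using assms eigenfield_sign[OF assms(1)] by (auto simp: eigenfield_J G_linear)
qed

text \<open>Differentiate \<open>G Y Z = 0\<close>.\<close>

lemma eigenfield_derivative_orthogonal:
  assumes "eigenfield e Y" "eigenfield (- e) Z" "X \<in> VF"
  shows "G (D X Y) Z p = - G Y (D X Z) p"
proof -
  have "G Y Z = 0" using eigenfield_orthogonal[OF assms(1,2)] by auto
  then have "X p (G Y Z) = 0" using tangent_vector_0[OF tangent[OF assms(3)]] by simp
  then show ?thesis using metric_derivative(1)[of X Y Z p] assms by simp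
qed

lemma eigenfield_D':
  assumes "eigenfield e Y" "X \<in> VF"
  shows "eigenfield e (D' X Y)"
proof -
  have "cov_endo D' P X Y = 0"
    using canonical assms by (simp add: canonical_connection_def natural_connection_def)
  then show ?thesis
    using assms
    by (simp add: cov_endo_def eigenfield_def linear_connection_scaleR[OF conn(2)])
qed

lemma G_cov_endo_same:
  assumes "eigenfield e Y" "eigenfield e Z" "X \<in> VF"
  shows "G (cov_endo D P X Y) Z p = 0"
  using assms
  by (simp add: cov_endo_def eigenfield_J linear_connection_scaleR[OF conn(1)] G_linear J_self_adjoint)

text \<open>\<open>(D\<^sub>X P) Y\<close> is \<open>e\<close> times \<open>(1 - e P)\<close> applied to \<open>D X Y\<close>: it doubles the component of
  \<open>D X Y\<close> normal to the distribution of \<open>Y\<close> and, as in \<open>G_cov_endo_same\<close>, kills the tangential one.\<close>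

lemma G_cov_endo_opposite:
  assumes "eigenfield e Y" "eigenfield (- e) Z" "X \<in> VF"
  shows "G (cov_endo D P X Y) Z p = 2 * e * G (D X Y) Z p"
  using assms
  by (simp add: cov_endo_def eigenfield_J linear_connection_scaleR[OF conn(1)] G_linear J_self_adjoint)

text \<open>This is all that the W3 condition says: when two arguments are of one sign and the
  third is of the other, one of the three cyclic terms vanishes, and the other two are the second
  fundamental form with its arguments in both orders.\<close>

lemma second_fundamental_form_skew:
  assumes "eigenfield e X" "eigenfield e Y" "eigenfield (- e) Z"
  shows "G (D X Y) Z p + G (D Y X) Z p = 0"
proof -
  have X': "eigenfield (- (- e)) X" using assms by simp
  have "(F_tensor g P D X Y Z + F_tensor g P D Y Z X + F_tensor g P D Z X Y) p = 0"
    using W3 assms by (simp add: W3_manifold_def)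
  then have "2 * e * G (D X Y) Z p + 2 * (- e) * G (D Y Z) X p = 0"
    using G_cov_endo_opposite[OF assms(2,3), of X p] G_cov_endo_opposite[OF assms(3) X', of Y p]
      G_cov_endo_same[OF assms(1,2), of Z p] assms
    by (simp add: F_tensor_def)
  moreover have "G (D Y Z) X p = - G (D Y X) Z p"
    using eigenfield_derivative_orthogonal[OF assms(1,3), of Y p] assms by (simp add: G_sym)
  ultimately show ?thesis
    using eigenfield_sign[OF assms(1)] by auto
qed

section \<open>The torsion of the canonical connection\<close>

lemma torsion_skew: "T X Y = - T Y X"
  by (simp add: torsion_def lie_bracket_def fun_eq_iff)

lemma torsion_linear:
  assumes "X \<in> VF" "Z \<in> VF"
  shows "Y \<in> VF \<Longrightarrow> T (X + Y) Z = T X Z + T Y Z"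
    and "Y \<in> VF \<Longrightarrow> T Z (X + Y) = T Z X + T Z Y"
    and "T (c *\<^sub>R X) Z = c *\<^sub>R T X Z"
    and "T Z (c *\<^sub>R X) = c *\<^sub>R T Z X"
    and "Y \<in> VF \<Longrightarrow> T Z (X - Y) = T Z X - T Z Y"
proof -
  have scale: "T (c *\<^sub>R X) Z = c *\<^sub>R T X Z" "T Z (c *\<^sub>R X) = c *\<^sub>R T Z X"
    if "X \<in> VF" for X c
    using assms that
    by (simp_all add: torsion_def lie_bracket_eq linear_connection_scaleR[OF conn(1)]
        linear_connection_scaleR[OF conn(2)] scaleR_diff_right)
  have add: "T (X + Y) Z = T X Z + T Y Z" "T Z (X + Y) = T Z X + T Z Y" if "Y \<in> VF" for Y
  proof -
    have "D (X + Y) Z = D X Z + D Y Z" "D Z (X + Y) = D Z X + D Z Y"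
      "D' (X + Y) Z = D' X Z + D' Y Z" "D' Z (X + Y) = D' Z X + D' Z Y"
      using conn assms that by (simp_all add: linear_connection_def)
    then show "T (X + Y) Z = T X Z + T Y Z" "T Z (X + Y) = T Z X + T Z Y"
      using assms that by (simp_all add: torsion_def lie_bracket_eq)
  qed
  show "Y \<in> VF \<Longrightarrow> T (X + Y) Z = T X Z + T Y Z" "Y \<in> VF \<Longrightarrow> T Z (X + Y) = T Z X + T Z Y"
    "T (c *\<^sub>R X) Z = c *\<^sub>R T X Z" "T Z (c *\<^sub>R X) = c *\<^sub>R T Z X"
    using add scale assms by simp_all
  show "T Z (X - Y) = T Z X - T Z Y" if "Y \<in> VF"
    using add(2)[of "(-1) *\<^sub>R Y"] scale(2)[of Y "-1"] that by simp
qed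

lemma G_torsion_skew: "X \<in> VF \<Longrightarrow> Y \<in> VF \<Longrightarrow> Z \<in> VF \<Longrightarrow> G (T X Y) Z p = - G (T Y X) Z p"
  using torsion_skew[of X Y] by (simp add: G_linear)

text \<open>If \<open>J X = e X\<close> and \<open>J Z = e Z\<close>, the last two terms of the condition defining the canonical
  connection repeat the first two.\<close>

lemma torsion_exchange:
  assumes "eigenfield e X" "eigenfield e Z" "Y \<in> VF"
  shows "G (T X Y) Z p = G (T Z Y) X p"
proof -
  have "(torsion3 g D' X Y Z + torsion3 g D' Y Z X + torsion3 g D' (J X) Y (J Z)
    + torsion3 g D' Y (J Z) (J X)) p = 0"
    using canonical assms by (simp add: canonical_connection_def)
  then have "G (T X Y) Z p + G (T Y Z) X p = 0"
    using assms eigenfield_sign[OF assms(1)]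
    by (auto simp: torsion3_def eigenfield_J torsion_linear G_linear)
  then show ?thesis using G_torsion_skew[of Y Z X p] assms by simp
qed

text \<open>A trilinear form that is symmetric in the first and third arguments and skew in the
  first two vanishes.\<close>

lemma torsion_same:
  assumes "eigenfield e X" "eigenfield e Y" "eigenfield e Z"
  shows "G (T X Y) Z p = 0"
proof -
  note VF = assms[THEN eigenfield_VF]
  have "G (T X Y) Z p = G (T Z Y) X p" by (rule torsion_exchange[OF assms(1,3) VF(2)])
  also have "\<dots> = - G (T Y Z) X p" by (rule G_torsion_skew[OF VF(3,2,1)])
  also have "G (T Y Z) X p = G (T X Z) Y p" by (rule torsion_exchange[OF assms(2,1) VF(3)])
  also have "G (T X Z) Y p = - G (T Z X) Y p" by (rule G_torsion_skew[OF VF(1,3,2)])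
  also have "G (T Z X) Y p = G (T Y X) Z p" by (rule torsion_exchange[OF assms(3,2) VF(1)])
  also have "G (T Y X) Z p = - G (T X Y) Z p" by (rule G_torsion_skew[OF VF(2,1,3)])
  finally show ?thesis by simp
qed

text \<open>By \<open>torsion_exchange\<close> it suffices that the sum with \<open>X\<close> and \<open>Z\<close> interchanged is zero. In this
  sum the derivatives along \<open>Y\<close> cancel, since \<open>D\<close> and \<open>D'\<close> are both metric, and what is left is the
  symmetric part of the second fundamental form, which is zero.\<close>

lemma torsion_opposite_aux:
  assumes "eigenfield e X" "eigenfield (- e) Y" "eigenfield e Z"
  shows "G (T X Y) Z p = 0"
proof -
  have T: "G (T U Y) W p = - G (D' Y U) W p + G (D Y U) W p + G (D U W) Y p"
    if "eigenfield e U" "eigenfield e W" for U W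
  proof -
    have W: "eigenfield (- (- e)) W" using that by simp
    have "G (D' U Y) W p = 0"
      using eigenfield_orthogonal[OF eigenfield_D'[OF assms(2), of U] W] that by simp
    moreover have "G (D U Y) W p = - G (D U W) Y p"
      using eigenfield_derivative_orthogonal[OF that(2) assms(2), of U p] that assms
      by (simp add: G_sym)
    ultimately show ?thesis
      using that assms by (simp add: torsion_def lie_bracket_eq G_linear)
  qed
  have "G (D' Y X) Z p + G (D' Y Z) X p = G (D Y X) Z p + G (D Y Z) X p"
    using metric_derivative[of Y X Z p] assms by (simp add: G_sym)
  then have "G (T X Y) Z p + G (T Z Y) X p = 0"
    using T[of X Z] T[of Z X] second_fundamental_form_skew[of e X Z Y p] assms by simp
  then show ?thesis using torsion_exchange[of e X Z Y p] assms by simp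
qed

text \<open>For the component of the sign of \<open>Y\<close>, exchange the roles of \<open>X\<close> and \<open>Y\<close>.\<close>

lemma torsion_opposite:
  assumes "eigenfield e X" "eigenfield (- e) Y"
  shows "T X Y = 0"
proof (rule eq_zero_by_metric)
  fix Z p assume "Z \<in> VF"
  then obtain U W where UW: "eigenfield e U" "eigenfield (- e) W" "Z = U + W"
    by (rule eigenfield_decomposition[OF _ eigenfield_square[OF assms(1)]])
  have "G (T X Y) U p = 0" using torsion_opposite_aux assms UW by blast
  moreover have "G (T Y X) W p = 0"
    by (rule torsion_opposite_aux[of "- e"]) (use assms UW in auto)
  ultimately show "G (T X Y) Z p = 0"
    using G_torsion_skew[of X Y W p] assms UW by (simp add: G_linear)
qed (use assms in simp)

text \<open>The component \<open>U\<close> of \<open>T X Y\<close> of the sign of \<open>X\<close> and \<open>Y\<close> is orthogonal to every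
  field, by \<open>torsion_same\<close>.\<close>

lemma eigenfield_torsion:
  assumes "eigenfield e X" "eigenfield e Y"
  shows "eigenfield (- e) (T X Y)"
proof -
  obtain U W where UW: "eigenfield e U" "eigenfield (- e) W" "T X Y = U + W"
    by (rule eigenfield_decomposition[OF VF_brackets(2)[OF assms[THEN eigenfield_VF]]
          eigenfield_square[OF assms(1)]])
  have "G U Z p = 0" if ZV: "Z \<in> VF" for Z p
  proof -
    obtain Z1 Z2 where Z: "eigenfield e Z1" "eigenfield (- e) Z2" "Z = Z1 + Z2"
      by (rule eigenfield_decomposition[OF ZV eigenfield_square[OF assms(1)]])
    have "G (T X Y) Z1 p = 0" using torsion_same assms Z by blast
    moreover have "G W Z1 p = 0" using eigenfield_orthogonal[of e Z1 W p] UW Z by (simp add: G_sym)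
    moreover have "G U Z2 p = 0" using eigenfield_orthogonal UW Z by blast
    ultimately show ?thesis using UW Z by (simp add: G_linear)
  qed
  then have "U = 0" using eq_zero_by_metric UW by simp
  then show ?thesis using UW by simp
qed

text \<open>The normal component of \<open>T X Y\<close> is that of \<open>- lie_bracket X Y\<close>, because \<open>D' X Y\<close> and
  \<open>D' Y X\<close> are tangential. With \<open>lie_bracket X Y = D X Y - D Y X\<close>, the skew second fundamental form
  doubles the term.\<close>

lemma torsion_integrability:
  assumes "eigenfield e X" "eigenfield e Y" "eigenfield (- e) Z"
  shows "G (T X Y) Z p = - 2 * G (D X Y) Z p"
proof -
  have "G (D' X Y) Z p = 0" "G (D' Y X) Z p = 0"
    using assms by (auto intro!: eigenfield_orthogonal[of e] eigenfield_D')
  then show ?thesis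
    using second_fundamental_form_skew[OF assms, of p] assms
    by (simp add: torsion_def lie_bracket_eq G_linear)
qed

section \<open>The Bianchi identity\<close>

text \<open>Pair the Bianchi identity for \<open>X\<close>, \<open>Z\<close>, \<open>Y\<close> with \<open>W\<close>. The derivative terms with \<open>T Z Y\<close> and
  \<open>T Y X\<close> are zero, \<open>D' Y (T X Z)\<close> has the sign of \<open>Y\<close>, and a torsion with an argument of the
  sign of \<open>W\<close> is orthogonal to \<open>W\<close>. There remains \<open>T Y (lie_bracket X Z)\<close>, where only the
  part \<open>- T X Z\<close> of the bracket \<open>D' X Z - D' Z X - T X Z\<close> contributes.\<close>

lemma torsion_torsion_eigenfields:
  assumes R: "riemannian_P_tensor A P (curvature4 g D')"
    and "eigenfield e X" "eigenfield e Z" "eigenfield (- e) Y" "eigenfield e W"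
  shows "G (T Y (T X Z)) W p = 0"
proof -
  have "curvature4 g D' X Z Y W + curvature4 g D' Z Y X W + curvature4 g D' Y X Z W = 0"
    using R assms(2-)[THEN eigenfield_VF] unfolding riemannian_P_tensor_def by blast
  moreover have "curvature D' U V Q \<in> VF" if "U \<in> VF" "V \<in> VF" "Q \<in> VF" for U V Q
    using that by (simp add: curvature_def)
  ultimately have "G (curvature D' X Z Y + curvature D' Z Y X + curvature D' Y X Z) W p = 0"
    using assms(2-) by (simp add: curvature4_def G_linear fun_eq_iff)
  moreover have "T Z Y = 0" "T Y X = 0"
    using torsion_opposite[of e Z Y] torsion_opposite[of "- e" Y X] assms(2-) by auto
  moreover have "D' V 0 = 0" if "V \<in> VF" for V
    using linear_connection_scaleR(2)[OF conn(2) that that, of 0] by simp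
  ultimately have B: "G (D' Y (T X Z)) W p + G (T X (lie_bracket Z Y)) W p
      + G (T Z (lie_bracket Y X)) W p + G (T Y (lie_bracket X Z)) W p = 0"
    using assms(2-) first_Bianchi_with_torsion[OF conn(2) atlas, of X Z Y]
    by (simp add: G_linear)
  have "G (D' Y (T X Z)) W p = 0"
    by (rule eigenfield_orthogonal[of "- e"]) (use assms(2-) in \<open>auto intro: eigenfield_D' eigenfield_torsion\<close>)
  moreover have same: "G (T U V) W p = 0" if U: "eigenfield e U" and V: "V \<in> VF" for U V
  proof -
    obtain V1 V2 where V12: "eigenfield e V1" "eigenfield (- e) V2" "V = V1 + V2"
      by (rule eigenfield_decomposition[OF V eigenfield_square[OF U]])
    have "T U V = T U V1"
      using V12 U torsion_opposite[OF U V12(2)] by (simp add: torsion_linear)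
    then show ?thesis using torsion_same[OF U V12(1) assms(5)] by simp
  qed
  moreover have "G (T Y (lie_bracket X Z)) W p = - G (T Y (T X Z)) W p"
  proof -
    have "eigenfield e (D' X Z)" "eigenfield e (D' Z X)" using assms eigenfield_D' by auto
    then have 0: "T (D' X Z) Y = 0" "T (D' Z X) Y = 0" using torsion_opposite assms(4) by auto
    have "lie_bracket X Z = D' X Z - D' Z X - T X Z"
      by (simp add: torsion_def)
    then show ?thesis
      using assms(2-) 0 torsion_skew[of Y "D' X Z"] torsion_skew[of Y "D' Z X"]
      by (simp add: torsion_linear G_linear)
  qed
  ultimately show ?thesis using B assms(2-) by simp
qed

text \<open>For \<open>X\<close> and \<open>Z\<close> of equal sign \<open>e\<close>, \<open>T X Z\<close> has sign \<open>- e\<close>. If \<open>Y\<close> has sign \<open>e\<close>, the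
  outer torsion is one of opposite signs; if \<open>Y\<close> has sign \<open>- e\<close>, its value has sign \<open>e\<close> and
  is zero by \<open>torsion_torsion_eigenfields\<close>.\<close>

lemma torsion_torsion:
  assumes R: "riemannian_P_tensor A P (curvature4 g D')"
    and "X \<in> VF" "Y \<in> VF" "Z \<in> VF"
  shows "T Y (T X Z) = 0"
proof -
  have equal_sign_case: "T Y (T X Z) = 0" if eig: "eigenfield e X" "eigenfield e Z" "Y \<in> VF" for e X Y Z
  proof -
    note e = eigenfield_square[OF eig(1)]
    obtain Y1 Y2 where Y: "eigenfield e Y1" "eigenfield (- e) Y2" "Y = Y1 + Y2"
      by (rule eigenfield_decomposition[OF eig(3) e])
    note T = eigenfield_torsion[OF eig(1,2)]
    have "T Y1 (T X Z) = 0"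
      by (rule torsion_opposite[OF Y(1) T])
    moreover have "T Y2 (T X Z) = 0"
    proof (rule eq_zero_by_metric)
      fix W p assume "W \<in> VF"
      then obtain W1 W2 where W: "eigenfield e W1" "eigenfield (- e) W2" "W = W1 + W2"
        by (rule eigenfield_decomposition[OF _ e])
      have "G (T Y2 (T X Z)) W1 p = 0"
        by (rule torsion_torsion_eigenfields[OF R eig(1,2) Y(2) W(1)])
      moreover have "G (T Y2 (T X Z)) W2 p = 0"
        by (rule torsion_same[OF Y(2) T W(2)])
      ultimately show "G (T Y2 (T X Z)) W p = 0"
        using W Y eig by (simp add: G_linear)
    qed (use Y eig in simp)
    ultimately show ?thesis using Y eig by (simp add: torsion_linear)
  qed
  show ?thesis
    using assms(2,4)
  proof (rule bilinear_zero_by_eigenfields[where b = "\<lambda>X Z. T Y (T X Z)"])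
    fix e X Z assume "eigenfield e X" "eigenfield (- e) Z"
    then have "T Y (T X Z) = T Y (0 *\<^sub>R Y)" by (simp add: torsion_opposite)
    then show "T Y (T X Z) = 0" using torsion_linear(4)[of Y Y 0] assms(3) by simp
  qed (use equal_sign_case assms(3) in \<open>auto simp: torsion_linear\<close>)
qed

section \<open>The derivative of the almost product structure in terms of the torsion\<close>

lemma cov_endo_linear:
  assumes "X \<in> VF" "Z \<in> VF"
  shows "Y \<in> VF \<Longrightarrow> cov_endo D P (X + Y) Z = cov_endo D P X Z + cov_endo D P Y Z"
    "Y \<in> VF \<Longrightarrow> cov_endo D P Z (X + Y) = cov_endo D P Z X + cov_endo D P Z Y"
    "cov_endo D P (c *\<^sub>R X) Z = c *\<^sub>R cov_endo D P X Z"
    "cov_endo D P Z (c *\<^sub>R X) = c *\<^sub>R cov_endo D P Z X"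
    "cov_endo D P (- X) Z = - cov_endo D P X Z"
    "cov_endo D P Z (- X) = - cov_endo D P Z X"
proof -
  show "cov_endo D P (X + Y) Z = cov_endo D P X Z + cov_endo D P Y Z"
    "cov_endo D P Z (X + Y) = cov_endo D P Z X + cov_endo D P Z Y" if "Y \<in> VF"
  proof -
    have "D (X + Y) U = D X U + D Y U" "D U (X + Y) = D U X + D U Y" 
      "D U (J X + J Y) = D U (J X) + D U (J Y)" if "U \<in> VF" for U
      using conn assms \<open>Y \<in> VF\<close> that by (simp_all add: linear_connection_def)
    then show "cov_endo D P (X + Y) Z = cov_endo D P X Z + cov_endo D P Y Z"
      "cov_endo D P Z (X + Y) = cov_endo D P Z X + cov_endo D P Z Y"
      using assms that by (simp_all add: cov_endo_def J_linear)
  qed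
  have scale: "cov_endo D P (c *\<^sub>R X) Z = c *\<^sub>R cov_endo D P X Z"
    "cov_endo D P Z (c *\<^sub>R X) = c *\<^sub>R cov_endo D P Z X" for c
    using assms
    by (simp_all add: cov_endo_def J_linear linear_connection_scaleR[OF conn(1)] scaleR_diff_right)
  show "cov_endo D P (c *\<^sub>R X) Z = c *\<^sub>R cov_endo D P X Z"
    "cov_endo D P Z (c *\<^sub>R X) = c *\<^sub>R cov_endo D P Z X"
    by (fact scale)+
  show "cov_endo D P (- X) Z = - cov_endo D P X Z"
    "cov_endo D P Z (- X) = - cov_endo D P Z X"
    using scale[of "-1"] by simp_all
qed

lemma VF_cov_endo [simp]: "X \<in> VF \<Longrightarrow> Y \<in> VF \<Longrightarrow> cov_endo D P X Y \<in> VF"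
  by (simp add: cov_endo_def)

text \<open>For opposite signs the first two terms cancel each other. For equal signs \<open>e\<close> they add up to
  \<open>2 e (D\<^sub>X P) Z\<close>, which is \<open>4\<close> times the normal component of \<open>D X Z\<close>, while \<open>T X Z\<close> is \<open>-2\<close> times
  that component.\<close>

lemma cov_endo_sum_eq_torsion:
  assumes "X \<in> VF" "Z \<in> VF"
  shows "cov_endo D P X (J Z) + cov_endo D P (J X) Z + 2 *\<^sub>R T X Z = 0"
  using assms
proof (rule bilinear_zero_by_eigenfields[where
      b = "\<lambda>X Z. cov_endo D P X (J Z) + cov_endo D P (J X) Z + 2 *\<^sub>R T X Z"])
  fix e X Z assume eig: "eigenfield e X" "eigenfield e Z"
  note e = eigenfield_square[OF eig(1)]
  have E: "cov_endo D P X (J Z) + cov_endo D P (J X) Z = (2 * e) *\<^sub>R cov_endo D P X Z"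
    using eig by (simp add: eigenfield_J cov_endo_linear flip: scaleR_add_left)
  show "cov_endo D P X (J Z) + cov_endo D P (J X) Z + 2 *\<^sub>R T X Z = 0"
    unfolding E
  proof (rule eq_zero_by_metric)
    fix U p assume "U \<in> VF"
    then obtain U1 U2 where U: "eigenfield e U1" "eigenfield (- e) U2" "U = U1 + U2"
      by (rule eigenfield_decomposition[OF _ e])
    have "(2 * e) * (2 * e) = 4" using e by simp
    then show "G ((2 * e) *\<^sub>R cov_endo D P X Z + 2 *\<^sub>R T X Z) U p = 0"
      using U eig G_cov_endo_same[OF eig(2) U(1), of X p] torsion_same[OF eig U(1), of p]
        G_cov_endo_opposite[OF eig(2) U(2), of X p] torsion_integrability[OF eig U(2), of p]
      by (simp add: G_linear)
  qed (use eig in simp)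
next
  fix e X Z assume eig: "eigenfield e X" "eigenfield (- e) Z"
  then show "cov_endo D P X (J Z) + cov_endo D P (J X) Z + 2 *\<^sub>R T X Z = 0"
    by (simp add: eigenfield_J cov_endo_linear torsion_opposite)
qed (simp_all add: J_linear cov_endo_linear torsion_linear scaleR_add_right)

text \<open>Here equal signs of \<open>Y\<close> and \<open>W\<close> make the two terms on the left cancel. For opposite signs the
  left-hand side is \<open>- 4 g(D Y W, U)\<close>, where only the component of \<open>U\<close> of the sign of \<open>Y\<close> counts;
  moving the derivative to that component gives \<open>4 g(D Y U, W)\<close>, and
  \<open>torsion_integrability\<close> applies.\<close>

lemma cov_endo_diff_eq_torsion:
  assumes "Y \<in> VF" "W \<in> VF" "U \<in> VF"
  shows "G (cov_endo D P (J Y) W - cov_endo D P Y (J W)) U p = - 2 * G (T Y U) W p"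
proof -
  have "G (cov_endo D P (J Y) W - cov_endo D P Y (J W)) U p + 2 * G (T Y U) W p = 0"
    using assms(1,2)
  proof (rule bilinear_zero_by_eigenfields[where
        b = "\<lambda>Y W. G (cov_endo D P (J Y) W - cov_endo D P Y (J W)) U p + 2 * G (T Y U) W p"])
    fix e Y W assume eig: "eigenfield e Y" "eigenfield e W"
    note e = eigenfield_square[OF eig(1)]
    obtain U1 U2 where U: "eigenfield e U1" "eigenfield (- e) U2" "U = U1 + U2"
      by (rule eigenfield_decomposition[OF assms(3) e])
    have "cov_endo D P (J Y) W - cov_endo D P Y (J W) = 0"
      using eig by (simp add: eigenfield_J cov_endo_linear)
    moreover have "G (T Y U) W p = 0"
      using U eig torsion_same[OF eig(1) U(1) eig(2)] torsion_opposite[OF eig(1) U(2)]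
      by (simp add: torsion_linear G_linear)
    ultimately show "G (cov_endo D P (J Y) W - cov_endo D P Y (J W)) U p + 2 * G (T Y U) W p = 0"
      using assms by (simp add: G_zero)
  next
    fix e Y W assume eig: "eigenfield e Y" "eigenfield (- e) W"
    note e = eigenfield_square[OF eig(1)]
    obtain U1 U2 where U: "eigenfield e U1" "eigenfield (- e) U2" "U = U1 + U2"
      by (rule eigenfield_decomposition[OF assms(3) e])
    then have U1: "eigenfield (- (- e)) U1" by simp
    have E: "cov_endo D P (J Y) W - cov_endo D P Y (J W) = (2 * e) *\<^sub>R cov_endo D P Y W"
      using eig by (simp add: eigenfield_J cov_endo_linear flip: scaleR_add_left)
    have "G (D Y W) U1 p = - G (D Y U1) W p"
      using eigenfield_derivative_orthogonal[OF U(1) eig(2), of Y p] U eig by (simp add: G_sym)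
    moreover have "(2 * e) * (2 * e) = 4" using e by simp
    ultimately show "G (cov_endo D P (J Y) W - cov_endo D P Y (J W)) U p + 2 * G (T Y U) W p = 0"
      using U eig G_cov_endo_same[OF eig(2) U(2), of Y p] torsion_opposite[OF eig(1) U(2)]
        G_cov_endo_opposite[OF eig(2) U1, of Y p] torsion_integrability[OF eig(1) U(1) eig(2), of p]
      unfolding E by (simp add: G_linear torsion_linear)
  qed (use assms(3) in \<open>simp_all add: J_linear cov_endo_linear torsion_linear G_linear\<close>)
  then show ?thesis by simp
qed

end

theorem theorem5p2:
  fixes A :: "('a::{t2_space, second_countable_topology}, 'e::euclidean_space) chart set"
    and P :: "'a endo" and g :: "'a metric"
    and D D' :: "'a connection"
    and x y z w :: "'a vfield"
  assumes "levi_civita A g D"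
    and "W3_manifold A D P g"
    and "canonical_connection A P g D'"
    and "riemannian_P_tensor A P (curvature4 g D')"
    and "x \<in> vector_fields A" "y \<in> vector_fields A" "z \<in> vector_fields A" "w \<in> vector_fields A"
  shows "metric_app g
      (cov_endo D P x (endo_app P z) + cov_endo D P (endo_app P x) z)
      (cov_endo D P (endo_app P y) w - cov_endo D P y (endo_app P w)) = 0"
proof
  fix p
  interpret canonical_W3 A P g D D'
    using assms(1-3) by unfold_locales
  let ?E = "cov_endo D P x (J z) + cov_endo D P (J x) z"
  let ?F = "cov_endo D P (J y) w - cov_endo D P y (J w)"
  note xyzw = assms(5-8)
  have E: "?E = (- 2) *\<^sub>R T x z"
    using cov_endo_sum_eq_torsion[of x z] xyzw by (simp add: eq_neg_iff_add_eq_0)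
  have "G ?E ?F p = - 2 * G ?F (T x z) p"
    unfolding E using xyzw G_left(2)[of "T x z" ?F "- 2" p] G_sym[of "T x z" ?F p] by simp
  also have "\<dots> = 4 * G (T y (T x z)) w p"
    using cov_endo_diff_eq_torsion[of y w "T x z" p] xyzw by simp
  also have "\<dots> = 0"
    using torsion_torsion[OF assms(4), of x y z] xyzw by (simp add: G_zero)
  finally show "G ?E ?F p = 0 p" by simp
qed

end
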